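(* Let $A,B$ be $p\times n$ matrices with entries in $\mathbb{R}_{\max}$, where every column of $B$ has at least one entry different from $-\infty$, and consider the system $Ax\geq Bx$. For $j\in\{1,\dots,p\}$ let $H_j:=\{x\in\mathbb{R}_{\max}^n\mid A_jx\geq B_jx\}$, where $A_j,B_j$ are the $j$th rows of $A,B$, and let $V:=H_1\cap\cdots\cap H_p$. Let $u\in\mathbb{R}^n$, let $(\xi^k)$ be the sequence generated by the cyclic projection algorithm, $$\xi^0=u,\qquad \xi^{k+1}=P_{H_{(k+1\bmod p)}}(\xi^k)\quad(k\geq0),$$ and let $(\eta^k)$ be the sequence generated by the power algorithm, $$\eta^0=u,\qquad \eta^{k+1}=(B^{\#}A\eta^k)\wedge\eta^k\quad(k\geq0).$$ Then $$P_V(u)\leq\xi^{pk}\leq\eta^k\qquad\forall k\geq0.$$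
   Context: $\mathbb{R}_{\max}=\mathbb{R}\cup\{-\infty\}$ with addition $\oplus=\max$ and multiplication $\otimes=+$; matrix-vector products are max-plus: $(Ax)_i=\max_j(A_{ij}+x_j)$. Vectors are ordered entrywise and $\wedge$ is the entrywise minimum. $(l\bmod p)$ denotes the unique element of $\{1,\dots,p\}$ congruent to $l$ modulo $p$. $B^{\#}$ is the residuated operator $(B^{\#}y)_j=\min_{1\le i\le p}\big((-B_{ij})+'y_i\big)$, where $+'$ is the extension of addition to $\mathbb{R}\cup\{\pm\infty\}$ with $(+\infty)+'(-\infty)=(-\infty)+'(+\infty)=+\infty$. For $W=V$ or $W=H_j$, $P_W(x):=\max\{w\in W\mid w\leq x\}$ (the maximum exists). *)

theory Defs
  imports "HOL-Library.Extended_Real" "HOL-Number_Theory.Cong"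
begin

text \<open>
  The max-plus numbers are the extended reals other than \<open>\<infinity>\<close>. Addition on \<^typ>\<open>ereal\<close> satisfies
  \<open>\<infinity> + (- \<infinity>) = (- \<infinity>) + \<infinity> = \<infinity>\<close>, so it serves both as the max-plus multiplication (on \<open>Rmax\<close>)
  and as the extended addition \<open>+'\<close> occurring in the residuated operator.

  A \<open>p \<times> n\<close> matrix is a function \<open>A\<close> with \<open>A i j\<close> the entry in row \<open>i \<in> {1..p}\<close> and column \<open>j\<close>.
  Columns are indexed by a finite type, so that vectors in the column space carry the
  entrywise order and infimum of the function space. Rows are indexed by numbers because
  the cyclic algorithm visits them in order; values outside \<open>{1..p}\<close> are irrelevant.
\<close>

definition Rmax :: "ereal set" where
  "Rmax = UNIV - {\<infinity>}"

definition mp_apply :: "(nat \<Rightarrow> 'n::finite \<Rightarrow> ereal) \<Rightarrow> ('n \<Rightarrow> ereal) \<Rightarrow> nat \<Rightarrow> ereal" where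
  "mp_apply A x i = (MAX j. A i j + x j)"

definition residuated :: "nat \<Rightarrow> (nat \<Rightarrow> 'n::finite \<Rightarrow> ereal) \<Rightarrow> (nat \<Rightarrow> ereal) \<Rightarrow> 'n \<Rightarrow> ereal" where
  "residuated p B y j = (MIN i\<in>{1..p}. - B i j + y i)"

definition halfspace ::
    "(nat \<Rightarrow> 'n::finite \<Rightarrow> ereal) \<Rightarrow> (nat \<Rightarrow> 'n \<Rightarrow> ereal) \<Rightarrow> nat \<Rightarrow> ('n \<Rightarrow> ereal) set" where
  "halfspace A B i = {x. (\<forall>j. x j \<in> Rmax) \<and> mp_apply A x i \<ge> mp_apply B x i}"

definition solutions ::
    "nat \<Rightarrow> (nat \<Rightarrow> 'n::finite \<Rightarrow> ereal) \<Rightarrow> (nat \<Rightarrow> 'n \<Rightarrow> ereal) \<Rightarrow> ('n \<Rightarrow> ereal) set" where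
  "solutions p A B = (\<Inter>i\<in>{1..p}. halfspace A B i)"

definition mp_proj :: "('n \<Rightarrow> ereal) set \<Rightarrow> ('n \<Rightarrow> ereal) \<Rightarrow> 'n \<Rightarrow> ereal" where
  "mp_proj W x = (GREATEST w. w \<in> W \<and> w \<le> x)"

text \<open>The residue of \<open>l\<close> modulo \<open>p\<close> with representatives \<open>1, \<dots>, p\<close> instead of \<open>0, \<dots>, p - 1\<close>.\<close>

definition cyc_mod :: "nat \<Rightarrow> nat \<Rightarrow> nat" where
  "cyc_mod l p = (THE i. i \<in> {1..p} \<and> [i = l] (mod p))"

end

theory Submission imports Defs begin

text \<open>
  Half-spaces and their intersections are closed under suprema bounded in \<open>Rmax\<close>, so the
  projections are attained. Every solution below \<open>\<xi> k\<close> stays below \<open>\<xi> (k + 1)\<close>, which gives the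
  lower bound. For the upper bound, assume \<open>\<xi> (p * k) \<le> \<eta> k\<close>. As \<open>\<xi>\<close> decreases, for each row \<open>i\<close>
  the vector \<open>\<xi> (p * k + i)\<close> lies between \<open>\<xi> (p * (k + 1))\<close> and \<open>\<eta> k\<close>, and it satisfies the
  \<open>i\<close>th inequality. Residuating these inequalities entry by entry yields
  \<open>\<xi> (p * (k + 1)) \<le> residuated p B (mp_apply A (\<eta> k))\<close>.
\<close>

lemma mp_apply_le_iff: "mp_apply A x i \<le> c \<longleftrightarrow> (\<forall>j. A i j + x j \<le> c)"
  by (simp add: mp_apply_def)

lemma mp_apply_mono: "x \<le> y \<Longrightarrow> mp_apply A x i \<le> mp_apply A y i"
  unfolding mp_apply_le_iff
  by (metis add_left_mono le_funD mp_apply_le_iff order.refl order.trans)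

text \<open>This is one half of scalar residuation. For \<open>b = - \<infinity>\<close> the bound
  is vacuous, since \<open>\<infinity> + c = \<infinity>\<close> even when
  \<open>c = - \<infinity>\<close>.\<close>

lemma ereal_le_uminus_add_if:
  fixes b x c :: ereal
  assumes "b \<noteq> \<infinity>" "b + x \<le> c"
  shows "x \<le> - b + c"
  using assms by (cases b; cases x; cases c) auto

text \<open>The converse half must exclude \<open>x = \<infinity>\<close>, because
  \<open>- \<infinity> + \<infinity>\<close> evaluates to \<open>\<infinity>\<close>.\<close>

lemma ereal_add_le_if:
  fixes b x c :: ereal
  assumes "b \<noteq> \<infinity>" "x \<noteq> \<infinity>" "x \<le> - b + c"
  shows "b + x \<le> c"
  using assms by (cases b; cases x; cases c) auto

text \<open>Residuating \<open>B i j + w j \<le> mp_apply A (Sup S) i\<close> bounds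
  \<open>w j\<close> independently of \<open>w\<close>, so the bound passes to the supremum.
  Arbitrary \<open>S\<close> is allowed so that the lemma also serves intersections of
  half-spaces.\<close>

lemma halfspace_Sup_closed:
  assumes B: "\<And>j. B i j \<in> Rmax"
    and S: "S \<subseteq> halfspace A B i"
    and fin: "\<And>j. Sup S j \<in> Rmax"
  shows "Sup S \<in> halfspace A B i"
proof -
  have "B i j + Sup S j \<le> mp_apply A (Sup S) i" for j
  proof (rule ereal_add_le_if)
    show "B i j \<noteq> \<infinity>" "Sup S j \<noteq> \<infinity>"
      using B[of j] fin[of j] by (auto simp: Rmax_def)
    have "w j \<le> - B i j + mp_apply A (Sup S) i" if "w \<in> S" for w
    proof (rule ereal_le_uminus_add_if)
      show "B i j \<noteq> \<infinity>" by fact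
      have "B i j + w j \<le> mp_apply B w i"
        using mp_apply_le_iff by blast
      also have "\<dots> \<le> mp_apply A w i"
        using S that by (auto simp: halfspace_def)
      also have "\<dots> \<le> mp_apply A (Sup S) i"
        by (intro mp_apply_mono Sup_upper that)
      finally show "B i j + w j \<le> mp_apply A (Sup S) i" .
    qed
    then show "Sup S j \<le> - B i j + mp_apply A (Sup S) i"
      by (auto simp: Sup_fun_def intro: SUP_least)
  qed
  with fin show ?thesis
    by (simp add: halfspace_def mp_apply_le_iff)
qed

text \<open>\<open>GREATEST\<close> is informative only once a maximum is known to exist; here the
  supremum of the candidates is that maximum.\<close>

lemma mp_proj_greatest:
  fixes W :: "('n \<Rightarrow> ereal) set"
  assumes "Sup {w \<in> W. w \<le> x} \<in> W"
  shows "mp_proj W x \<in> W" "mp_proj W x \<le> x" "\<And>w. w \<in> W \<Longrightarrow> w \<le> x \<Longrightarrow> w \<le> mp_proj W x"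
proof -
  have "Sup {w \<in> W. w \<le> x} \<le> x"
    by (rule Sup_least) simp
  moreover have "w \<le> Sup {w \<in> W. w \<le> x}" if "w \<in> W \<and> w \<le> x" for w
    using that by (intro Sup_upper) simp
  ultimately have "mp_proj W x = Sup {w \<in> W. w \<le> x}"
    unfolding mp_proj_def using assms by (intro Greatest_equality) auto
  then show "mp_proj W x \<in> W" "mp_proj W x \<le> x" "\<And>w. w \<in> W \<Longrightarrow> w \<le> x \<Longrightarrow> w \<le> mp_proj W x"
    using assms \<open>Sup {w \<in> W. w \<le> x} \<le> x\<close> by (auto intro: Sup_upper)
qed

lemma Sup_below_in_Rmax:
  fixes x :: "'n \<Rightarrow> ereal"
  assumes "\<And>j. x j \<in> Rmax"
  shows "Sup {w \<in> W. w \<le> x} j \<in> Rmax"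
proof -
  have "Sup {w \<in> W. w \<le> x} \<le> x"
    by (rule Sup_least) simp
  then have "Sup {w \<in> W. w \<le> x} j \<le> x j"
    by (rule le_funD)
  with assms[of j] show ?thesis
    by (auto simp: Rmax_def)
qed

lemma halfspace_Sup_below:
  assumes "\<And>j. B i j \<in> Rmax" "\<And>j. x j \<in> Rmax"
  shows "Sup {w \<in> halfspace A B i. w \<le> x} \<in> halfspace A B i"
  using assms by (intro halfspace_Sup_closed Sup_below_in_Rmax) auto

lemma solutions_Sup_below:
  assumes "\<And>i j. i \<in> {1..p} \<Longrightarrow> B i j \<in> Rmax" "\<And>j. x j \<in> Rmax"
  shows "Sup {w \<in> solutions p A B. w \<le> x} \<in> solutions p A B"
  unfolding solutions_def
proof (rule INT_I)
  fix i assume "i \<in> {1..p}"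
  then show "Sup {w \<in> \<Inter> (halfspace A B ` {1..p}). w \<le> x} \<in> halfspace A B i"
    using assms by (intro halfspace_Sup_closed Sup_below_in_Rmax) auto
qed

lemma cyc_mod_eqI:
  assumes "i \<in> {1..p}" "[i = l] (mod p)"
  shows "cyc_mod l p = i"
  unfolding cyc_mod_def
proof (rule the_equality)
  fix i' assume i': "i' \<in> {1..p} \<and> [i' = l] (mod p)"
  \<comment> \<open>Reduction modulo \<open>p\<close> moves only \<open>p\<close>, to the value 0
    outside the range, so it is injective on \<open>{1..p}\<close>.\<close>
  have "m mod p = (if m = p then 0 else m)" if "m \<in> {1..p}" for m
    using that by auto
  moreover have "i' mod p = i mod p"
    using i' assms(2) by (simp add: cong_def)
  ultimately show "i' = i"
    using i' assms(1) by (auto split: if_splits)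
qed (use assms in auto)

lemma cyc_mod_range:
  assumes "p \<ge> 1"
  shows "cyc_mod l p \<in> {1..p}"
proof (cases "l mod p = 0")
  case True
  then have "cyc_mod l p = p"
    using assms by (intro cyc_mod_eqI) (auto simp: cong_def)
  then show ?thesis using assms by simp
next
  case False
  moreover have "l mod p < p" using assms by simp
  ultimately have "cyc_mod l p = l mod p"
    by (intro cyc_mod_eqI) (auto simp: cong_def)
  then show ?thesis using False \<open>l mod p < p\<close> by simp
qed

theorem theorem8p2:
  fixes p :: nat
    and A B :: "nat \<Rightarrow> 'n::finite \<Rightarrow> ereal"
    and u :: "'n \<Rightarrow> real"
    and \<xi> \<eta> :: "nat \<Rightarrow> 'n \<Rightarrow> ereal"
  assumes "p \<ge> 1"
    and "\<And>i j. i \<in> {1..p} \<Longrightarrow> A i j \<in> Rmax"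
    and "\<And>i j. i \<in> {1..p} \<Longrightarrow> B i j \<in> Rmax"
    and "\<And>j. \<exists>i\<in>{1..p}. B i j \<noteq> - \<infinity>"
    and "\<xi> 0 = (\<lambda>j. ereal (u j))"
    and "\<And>k. \<xi> (k + 1) = mp_proj (halfspace A B (cyc_mod (k + 1) p)) (\<xi> k)"
    and "\<eta> 0 = (\<lambda>j. ereal (u j))"
    and "\<And>k. \<eta> (k + 1) = inf (residuated p B (mp_apply A (\<eta> k))) (\<eta> k)"
  shows "\<forall>k. mp_proj (solutions p A B) (\<lambda>j. ereal (u j)) \<le> \<xi> (p * k) \<and> \<xi> (p * k) \<le> \<eta> k"
proof -
  note B = assms(3) and \<xi>0 = assms(5) and \<xi>Suc = assms(6) and \<eta>0 = assms(7) and \<eta>Suc = assms(8)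
  let ?H = "\<lambda>k. halfspace A B (cyc_mod (k + 1) p)"
  let ?v = "mp_proj (solutions p A B) (\<lambda>j. ereal (u j))"
  have row: "cyc_mod k p \<in> {1..p}" for k
    using assms(1) by (rule cyc_mod_range)
  have attained: "Sup {w \<in> ?H k. w \<le> x} \<in> ?H k" if "\<And>j. x j \<in> Rmax" for k x
    using that row B by (intro halfspace_Sup_below) auto
  \<comment> \<open>Each projection is attained only from a vector over \<open>Rmax\<close>;
    membership in the half-space passes this property on.\<close>
  have \<xi>_Rmax: "\<xi> k j \<in> Rmax" for k j
  proof (induction k arbitrary: j)
    case 0
    then show ?case by (simp add: \<xi>0 Rmax_def)
  next
    case (Suc k)
    from mp_proj_greatest(1)[OF attained[OF this]] show ?case
      using \<xi>Suc[of k] by (auto simp: halfspace_def)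
  qed
  have step: "\<xi> (k + 1) \<in> ?H k" "\<xi> (k + 1) \<le> \<xi> k"
    "\<And>w. w \<in> ?H k \<Longrightarrow> w \<le> \<xi> k \<Longrightarrow> w \<le> \<xi> (k + 1)" for k
    unfolding \<xi>Suc by (fact mp_proj_greatest[OF attained[of "\<xi> k" k, OF \<xi>_Rmax]])+
  have decr: "\<xi> m \<le> \<xi> k" if "k \<le> m" for k m
    using step(2) by (rule lift_Suc_antimono_le[of \<xi>, simplified Suc_eq_plus1, OF _ that])
  have below: "Sup {w \<in> solutions p A B. w \<le> \<xi> 0} \<in> solutions p A B"
    using B \<xi>_Rmax by (rule solutions_Sup_below)
  have v_le: "?v \<le> \<xi> 0"
    using mp_proj_greatest(2)[OF below] by (simp add: \<xi>0)
  have "?v \<in> solutions p A B"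
    using mp_proj_greatest(1)[OF below] by (simp add: \<xi>0)
  then have v: "?v \<in> ?H k" for k
    using row by (auto simp: solutions_def)
  have lower: "?v \<le> \<xi> k" for k
  proof (induction k)
    case 0
    show ?case by (rule v_le)
  next
    case (Suc k)
    then show ?case using step(3)[OF v] by simp
  qed
  have upper: "\<xi> (p * k) \<le> \<eta> k" for k
  proof (induction k)
    case 0
    then show ?case by (simp add: \<xi>0 \<eta>0)
  next
    case (Suc k)
    have "\<xi> (p * Suc k) j \<le> - B i j + mp_apply A (\<eta> k) i" if i: "i \<in> {1..p}" for i j
    proof (rule ereal_le_uminus_add_if)
      \<comment> \<open>The iterate right after the projection onto the \<open>i\<close>th
        half-space in the current sweep.\<close>
      let ?x = "\<xi> (p * k + i)"
      show "B i j \<noteq> \<infinity>"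
        using B[OF i, of j] by (auto simp: Rmax_def)
      have "cyc_mod (p * k + i) p = i"
        using i by (intro cyc_mod_eqI) (auto simp: cong_def)
      then have "?x \<in> halfspace A B i"
        \<comment> \<open>The subtraction is exact because \<open>i \<ge> 1\<close>.\<close>
        using step(1)[of "p * k + i - 1"] i by simp
      then have "mp_apply B ?x i \<le> mp_apply A ?x i"
        by (simp add: halfspace_def)
      also have "\<dots> \<le> mp_apply A (\<eta> k) i"
        using Suc decr[of "p * k" "p * k + i"] by (intro mp_apply_mono) auto
      finally have "mp_apply B ?x i \<le> mp_apply A (\<eta> k) i" .
      then have "B i j + ?x j \<le> mp_apply A (\<eta> k) i"
        by (simp add: mp_apply_le_iff)
      \<comment> \<open>The rest of the sweep only lowers entries, as
        \<open>i \<le> p\<close>.\<close>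
      moreover have "\<xi> (p * Suc k) j \<le> ?x j"
        using decr[of "p * k + i" "p * Suc k"] i by (auto simp: le_fun_def)
      ultimately show "B i j + \<xi> (p * Suc k) j \<le> mp_apply A (\<eta> k) i"
        by (meson add_left_mono order.trans)
    qed
    \<comment> \<open>With \<open>p \<ge> 1\<close> the minimum runs over a nonempty set of rows, so
      the rowwise bounds suffice.\<close>
    then have "\<xi> (p * Suc k) \<le> residuated p B (mp_apply A (\<eta> k))"
      using assms(1) by (auto simp: residuated_def le_fun_def)
    moreover have "\<xi> (p * Suc k) \<le> \<eta> k"
      using Suc decr[of "p * k" "p * Suc k"] by auto
    ultimately show ?case
      unfolding Suc_eq_plus1 \<eta>Suc by (rule inf_greatest)
  qed
  show ?thesis using lower upper by blast
qed

end
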